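(* The following identities of formal power series in $q$ hold. (1) For all integers $k\ge 2$: $$\sum_{i=0}^{\infty} q^{ki^2+(k-1)i}-\sum_{i=1}^{\infty} q^{k(i^2-i)+i}=(q;q)_{\infty}\sum_{l_1=0}^{\infty}\sum_{l_2=0}^{\infty}\cdots\sum_{l_{k-1}=0}^{\infty}\frac{q^{\sum_{j=1}^{k-1} i_j(i_j+1)}}{(q;q)_{l_{k-1}}^2\prod_{j=1}^{k-2}(q;q)_{l_j}},$$ where $i_j=\sum_{s=j}^{k-1}l_s$. (2) (Andrews–Gordon identity for the theta function) For all integers $k\ge 1$: $$\sum_{i=0}^{\infty}(-1)^i q^{k(i^2+i)}q^{i(i-1)/2}+\sum_{i=1}^{\infty}(-1)^i q^{k(i^2-i)}q^{i(i+1)/2}=(q;q)_{\infty}\sum_{l_1=0}^{\infty}\sum_{l_2=0}^{\infty}\cdots\sum_{l_{k-1}=0}^{\infty}\frac{q^{\sum_{j=1}^{k-1} i_j(i_j+1)}}{\prod_{j=1}^{k-1}(q;q)_{l_j}},$$ where $i_j=\sum_{s=j}^{k-1}l_s$.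
   Context: Notation: $(a;q)_n=\prod_{j=0}^{n-1}(1-aq^j)$ and $(a;q)_\infty=\prod_{j=0}^{\infty}(1-aq^j)$. Empty products equal $1$. When $k=1$ in (2) there are no summation variables and the multiple sum is interpreted as $1$. *)

theory Defs
  imports "HOL-Analysis.Analysis" "HOL-Computational_Algebra.Formal_Power_Series"
begin

definition qpoch :: "'a::comm_ring_1 \<Rightarrow> 'a \<Rightarrow> nat \<Rightarrow> 'a" where
  "qpoch a q n = (\<Prod>j<n. 1 - a * q ^ j)"

definition qpoch_inf :: "'a::{comm_ring_1, t2_space} \<Rightarrow> 'a \<Rightarrow> 'a" where
  "qpoch_inf a q = (\<Prod>j. 1 - a * q ^ j)"

text \<open>
  Infinite sums and products of formal power series are taken in the topology of the type
  \<^typ>\<open>'a fps\<close> (coefficientwise stabilisation). The following shows that the infinite product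
  \<open>(q;q)\<^sub>\<infinity>\<close> converges there, so that its value is not an artefact of the totality of
  \<^const>\<open>prodinf\<close>.
\<close>

lemma qpoch_inf_fps_X:
  "(\<lambda>j. 1 - fps_X * fps_X ^ j) has_prod (qpoch_inf fps_X fps_X :: 'a::field fps)"
proof -
  let ?f = "\<lambda>j. 1 - fps_X * fps_X ^ j :: 'a fps"
  let ?P = "\<lambda>n. \<Prod>j\<le>n. ?f j"
  define p where "p = Abs_fps (\<lambda>n. fps_nth (?P n) n)"
  have stable: "fps_nth (?P (m + d)) m = fps_nth (?P m) m" for m d
  proof (induction d)
    case (Suc d)
    have "?P (m + Suc d) = ?P (m + d) - ?P (m + d) * fps_X ^ (Suc (Suc (m + d)))"
      by (simp add: algebra_simps)
    moreover have "fps_nth (?P (m + d) * fps_X ^ (Suc (Suc (m + d)))) m = 0"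
      unfolding fps_X_power_mult_right_nth by simp
    ultimately have "fps_nth (?P (m + Suc d)) m = fps_nth (?P (m + d)) m"
      by (simp only: fps_sub_nth) simp
    then show ?case using Suc by simp
  qed simp
  have lim: "?P \<longlonglongrightarrow> p"
  proof (rule tendsto_fpsI)
    fix m
    have "fps_nth (?P n) m = fps_nth p m" if "n \<ge> m" for n
      using stable[of m "n - m"] that by (simp add: p_def)
    then show "eventually (\<lambda>n. fps_nth (?P n) m = fps_nth p m) sequentially"
      using eventually_sequentially by blast
  qed
  have "fps_nth p 0 = 1" by (simp add: p_def)
  then have "p \<noteq> 0" by auto
  with lim have "raw_has_prod ?f 0 p" by (simp add: raw_has_prod_def)
  then have "?f has_prod p" by (simp add: has_prod_def)
  moreover from this have "qpoch_inf fps_X fps_X = p"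
    using has_prod_unique unfolding qpoch_inf_def by metis
  ultimately show ?thesis by simp
qed

text \<open>
  A multi-index \<open>(l\<^sub>1, \<dots>, l\<^bsub>k-1\<^esub>)\<close> is an extensional function on \<open>{1..k-1}\<close>; the iterated sum
  over all \<open>l\<^sub>j \<ge> 0\<close> is taken as one unordered sum over these. For \<open>k = 1\<close> there is
  exactly one (empty) multi-index.
\<close>

definition multi_indices :: "nat \<Rightarrow> (nat \<Rightarrow> nat) set" where
  "multi_indices k = (\<Pi>\<^sub>E j\<in>{1..k-1}. UNIV)"

definition tail_sum :: "nat \<Rightarrow> (nat \<Rightarrow> nat) \<Rightarrow> nat \<Rightarrow> nat" where
  "tail_sum k l j = (\<Sum>s=j..k-1. l s)"

end

theory Submission
  imports Defs
begin

text \<open>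
  Both identities come from the Bailey chain relative to \<open>a = q\<close>. The \<open>q\<close>-Vandermonde sum shows
  that a Bailey pair \<open>(\<alpha>, \<beta>)\<close> yields a new one with \<open>\<alpha>'\<^sub>r = q\<^bsup>r(r+1)\<^esup> \<alpha>\<^sub>r\<close> and
  \<open>\<beta>'\<^sub>L = \<Sum>\<^bsub>M\<le>L\<^esub> q\<^bsup>M(M+1)\<^esup> \<beta>\<^sub>M / (q;q)\<^bsub>L-M\<^esub>\<close>. Iterating \<open>k - 1\<close> times turns \<open>\<beta>\<close> into the multiple
  sum truncated at \<open>i\<^sub>1 \<le> L\<close>, and \<open>L \<rightarrow> \<infinity>\<close> gives the claim. The starting pair has
  \<open>\<beta>\<^sub>L = 1 / (q;q)\<^sub>L\<^sup>2\<close> in (1); in (2) it is one step of the chain applied to the unit pair,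
  so that \<open>\<beta>\<^sub>L = 1 / (q;q)\<^sub>L\<close>. Both starting pairs are verified by telescoping. All limits are
  taken as congruences modulo \<open>q\<^sup>N\<close>.
\<close>

text \<open>Natural numbers with total at most \<open>M\<close> are each at most \<open>M\<close>,
  so the set lies in a finite box. Truncated multiple sums are thus genuine finite sums.\<close>

lemma finite_multi_indices_bounded:
  "finite {l. l \<in> (\<Pi>\<^sub>E s\<in>{j..K::nat}. UNIV) \<and> sum l {j..K} \<le> (M::nat)}"
proof (rule finite_subset)
  show "{l. l \<in> (\<Pi>\<^sub>E s\<in>{j..K}. UNIV) \<and> sum l {j..K} \<le> M} \<subseteq> (\<Pi>\<^sub>E s\<in>{j..K}. {..M})"
  proof
    fix l assume l: "l \<in> {l. l \<in> (\<Pi>\<^sub>E s\<in>{j..K}. UNIV) \<and> sum l {j..K} \<le> M}"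
    then have "l s \<le> M" if "s \<in> {j..K}" for s
      using member_le_sum[of s "{j..K}" l] that by fastforce
    then show "l \<in> (\<Pi>\<^sub>E s\<in>{j..K}. {..M})"
      using l by (auto simp: PiE_def)
  qed
qed (auto intro: finite_PiE)

subsection \<open>Bailey pairs\<close>

text \<open>Here \<open>e n\<close> plays the role of \<open>1 / (q;q)\<^sub>n\<close>, avoiding division in an integral domain.\<close>

locale q_reciprocals =
  fixes q :: "'b::idom" and e :: "nat \<Rightarrow> 'b"
  assumes e_0: "e 0 = 1"
    and e_Suc: "(1 - q ^ Suc n) * e (Suc n) = e n"
    and not_root_of_unity: "1 - q ^ Suc n \<noteq> 0"
begin

text \<open>
  Writing \<open>S N m\<close> for the left-hand side and splitting
  \<open>1 - q\<^sup>N = (1 - q\<^bsup>N-t\<^esup>) + q\<^bsup>N-t\<^esup> (1 - q\<^sup>t)\<close>, one finds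
  \<open>(1 - q\<^sup>N) S N m = S (N - 1) m + q\<^bsup>N+m\<^esup> S (N - 1) (m + 1)\<close>.
\<close>

lemma q_Vandermonde:
  "(\<Sum>t\<le>N. q ^ (t * t + t * m) * e (N - t) * e t * e (t + m)) = e N * e (N + m)"
proof (induction N arbitrary: m)
  case 0
  then show ?case by (simp add: e_0)
next
  case (Suc N)
  let ?S = "\<lambda>N m. \<Sum>t\<le>N. q ^ (t * t + t * m) * e (N - t) * e t * e (t + m)"
  let ?f = "\<lambda>t. q ^ (t * t + t * m) * e (Suc N - t) * e t * e (t + m)"
  have "(1 - q ^ Suc N) * ?S (Suc N) m =
      (\<Sum>t\<le>Suc N. (1 - q ^ (Suc N - t)) * ?f t) + (\<Sum>t\<le>Suc N. q ^ (Suc N - t) * (1 - q ^ t) * ?f t)"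
  proof -
    have "(1 - q ^ Suc N) * ?f t = (1 - q ^ (Suc N - t)) * ?f t + q ^ (Suc N - t) * (1 - q ^ t) * ?f t"
      if "t \<le> Suc N" for t
    proof -
      have "q ^ Suc N = q ^ (Suc N - t) * q ^ t"
        using that by (simp flip: power_add)
      then show ?thesis by (simp only: left_diff_distrib right_diff_distrib mult_1_left mult.assoc) simp
    qed
    then show ?thesis
      unfolding sum_distrib_left sum.distrib[symmetric] by (intro sum.cong) (simp_all only: atMost_iff)
  qed
  \<comment> \<open>The factor lowers \<open>e (Suc N - t)\<close> to \<open>e (N - t)\<close> and
    kills the term \<open>t = Suc N\<close>.\<close>
  also have "(\<Sum>t\<le>Suc N. (1 - q ^ (Suc N - t)) * ?f t) = ?S N m"
  proof -
    have "(1 - q ^ (Suc N - t)) * ?f t = q ^ (t * t + t * m) * e (N - t) * e t * e (t + m)"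
      if "t \<le> N" for t
    proof -
      have "(1 - q ^ (Suc N - t)) * e (Suc N - t) = e (N - t)"
        using e_Suc[of "N - t"] that by (simp add: Suc_diff_le)
      moreover have "(1 - q ^ (Suc N - t)) * ?f t =
          q ^ (t * t + t * m) * ((1 - q ^ (Suc N - t)) * e (Suc N - t)) * e t * e (t + m)"
        by (simp only: mult_ac)
      ultimately show ?thesis by (simp only:)
    qed
    then show ?thesis
      unfolding sum.atMost_Suc diff_self_eq_0 power_0 diff_self mult_zero_left add_0_right
      by (intro sum.cong) (simp_all only: atMost_iff)
  qed
  \<comment> \<open>Here the term \<open>t = 0\<close> vanishes; after the shift to
    \<open>Suc t\<close> the factor lowers \<open>e (Suc t)\<close> to \<open>e t\<close>, and
    \<open>m\<close> becomes \<open>Suc m\<close>.\<close>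
  also have "(\<Sum>t\<le>Suc N. q ^ (Suc N - t) * (1 - q ^ t) * ?f t) = q ^ (Suc N + m) * ?S N (Suc m)"
  proof -
    have "q ^ (N - t) * (1 - q ^ Suc t) * ?f (Suc t)
        = q ^ (Suc N + m) * (q ^ (t * t + t * Suc m) * e (N - t) * e t * e (t + Suc m))"
      if "t \<le> N" for t
    proof -
      have "q ^ (N - t) * (1 - q ^ Suc t) * ?f (Suc t) =
          (q ^ (N - t) * q ^ (Suc t * Suc t + Suc t * m)) * e (N - t) * ((1 - q ^ Suc t) * e (Suc t)) * e (t + Suc m)"
        by (simp add: mult_ac)
      also have "q ^ (N - t) * q ^ (Suc t * Suc t + Suc t * m) = q ^ (Suc N + m) * q ^ (t * t + t * Suc m)"
        using that by (simp add: algebra_simps flip: power_add)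
      finally show ?thesis unfolding e_Suc by (simp only: mult_ac)
    qed
    then show ?thesis
      unfolding sum.atMost_Suc_shift sum_distrib_left diff_Suc_Suc power_0 diff_self mult_zero_left mult_zero_right add_0_left
      by (intro sum.cong) (simp_all only: atMost_iff)
  qed
  also have "?S N m + q ^ (Suc N + m) * ?S N (Suc m) = e N * e (Suc N + m)"
    unfolding Suc.IH e_Suc[of "N + m", symmetric] by (simp add: algebra_simps)
  also have "\<dots> = (1 - q ^ Suc N) * (e (Suc N) * e (Suc N + m))"
    unfolding e_Suc[of N, symmetric] by (simp only: mult_ac)
  finally show ?case
    unfolding mult_left_cancel[OF not_root_of_unity] .
qed

text \<open>
  The usual denominator \<open>(q\<^sup>2;q)\<^bsub>L+r\<^esub>\<close> is replaced by \<open>(q;q)\<^bsub>L+r+1\<^esub>\<close>, which absorbs a factor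
  \<open>1 - q\<close> into \<open>\<alpha>\<close>.
\<close>

definition bailey_pair :: "(nat \<Rightarrow> 'b) \<Rightarrow> (nat \<Rightarrow> 'b) \<Rightarrow> bool" where
  "bailey_pair \<alpha> \<beta> \<longleftrightarrow> (\<forall>L. \<beta> L = (\<Sum>r\<le>L. \<alpha> r * e (L - r) * e (L + r + 1)))"

text \<open>Bailey's lemma at \<open>a = q\<close> with both free parameters sent to
  infinity.\<close>

definition bailey_step :: "(nat \<Rightarrow> 'b) \<Rightarrow> nat \<Rightarrow> 'b" where
  "bailey_step \<beta> L = (\<Sum>M\<le>L. e (L - M) * q ^ (M * (M + 1)) * \<beta> M)"

text \<open>After expanding \<open>\<beta> M\<close> and exchanging the sums, the coefficient of
  \<open>\<alpha> r\<close> is a sum over \<open>M\<close>. Putting \<open>M = r + t\<close> gives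
  \<open>M(M+1) = r(r+1) + t^2 + t(2r+1)\<close>, so it is the sum in \<open>q_Vandermonde\<close>
  with \<open>N = L - r\<close> and \<open>m = 2 * r + 1\<close>.\<close>

lemma bailey_pair_step:
  assumes "bailey_pair \<alpha> \<beta>"
  shows "bailey_pair (\<lambda>r. q ^ (r * (r + 1)) * \<alpha> r) (bailey_step \<beta>)"
  unfolding bailey_pair_def
proof
  fix L
  have inner: "(\<Sum>M=r..L. e (L - M) * q ^ (M * (M + 1)) * (e (M - r) * e (M + r + 1)))
      = q ^ (r * (r + 1)) * (e (L - r) * e (L + r + 1))" if "r \<le> L" for r
  proof -
    have "(\<Sum>M=r..L. e (L - M) * q ^ (M * (M + 1)) * (e (M - r) * e (M + r + 1)))
        = (\<Sum>t\<le>L - r. q ^ (r * (r + 1)) *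
             (q ^ (t * t + t * (2 * r + 1)) * e (L - r - t) * e t * e (t + (2 * r + 1))))"
    proof (rule sum.reindex_bij_witness[of _ "\<lambda>t. t + r" "\<lambda>M. M - r"])
      fix M assume "M \<in> {r..L}"
      then obtain t where M: "M = r + t" using le_Suc_ex by auto
      show "q ^ (r * (r + 1)) * (q ^ ((M - r) * (M - r) + (M - r) * (2 * r + 1)) * e (L - r - (M - r)) *
          e (M - r) * e (M - r + (2 * r + 1))) = e (L - M) * q ^ (M * (M + 1)) * (e (M - r) * e (M + r + 1))"
      proof -
        have M': "L - r - (M - r) = L - M" "M - r + (2 * r + 1) = M + r + 1"
          using M by auto
        have "q ^ (r * (r + 1)) * q ^ ((M - r) * (M - r) + (M - r) * (2 * r + 1)) = q ^ (M * (M + 1))"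
          by (simp add: M mult_2 mult_2_right algebra_simps flip: power_add)
        moreover have "x * (y * a * b * c) = (x * y) * a * b * c" for x y a b c :: 'b
          by (simp only: mult.assoc)
        ultimately show ?thesis
          by (simp only: M') (simp only: mult_ac)
      qed
    qed (use that in auto)
    also have "\<dots> = q ^ (r * (r + 1)) * (e (L - r) * e (L - r + (2 * r + 1)))"
      by (simp only: q_Vandermonde flip: sum_distrib_left)
    also have "L - r + (2 * r + 1) = L + r + 1" using that by simp
    finally show ?thesis .
  qed
  have "bailey_step \<beta> L =
      (\<Sum>M\<le>L. \<Sum>r\<le>M. \<alpha> r * (e (L - M) * q ^ (M * (M + 1)) * (e (M - r) * e (M + r + 1))))"
    using assms by (simp add: bailey_step_def bailey_pair_def sum_distrib_left mult_ac)
  also have "\<dots> = (\<Sum>r\<le>L. \<Sum>M=r..L. \<alpha> r * (e (L - M) * q ^ (M * (M + 1)) * (e (M - r) * e (M + r + 1))))"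
    unfolding sum.Sigma[OF finite_atMost ballI[OF finite_atMost]] 
      sum.Sigma[OF finite_atMost ballI[OF finite_atLeastAtMost]]
    by (rule sum.reindex_bij_witness[of _ "\<lambda>(a, b). (b, a)" "\<lambda>(a, b). (b, a)"]) auto
  also have "\<dots> = (\<Sum>r\<le>L. q ^ (r * (r + 1)) * \<alpha> r * e (L - r) * e (L + r + 1))"
  proof (rule sum.cong[OF refl])
    fix r assume "r \<in> {..L}"
    then show "(\<Sum>M=r..L. \<alpha> r * (e (L - M) * q ^ (M * (M + 1)) * (e (M - r) * e (M + r + 1))))
        = q ^ (r * (r + 1)) * \<alpha> r * e (L - r) * e (L + r + 1)"
      unfolding sum_distrib_left[symmetric] by (subst inner) (simp_all only: atMost_iff mult_ac)
  qed
  finally show "bailey_step \<beta> L = (\<Sum>r\<le>L. q ^ (r * (r + 1)) * \<alpha> r * e (L - r) * e (L + r + 1))" .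
qed

lemma bailey_pair_steps:
  assumes "bailey_pair \<alpha> \<beta>"
  shows "bailey_pair (\<lambda>r. q ^ (n * (r * (r + 1))) * \<alpha> r) ((bailey_step ^^ n) \<beta>)"
proof (induction n)
  case (Suc n)
  from bailey_pair_step[OF this] show ?case by (simp add: power_add mult_ac)
qed (use assms in simp)

section \<open>The two initial Bailey pairs\<close>

text \<open>The sum telescopes because
  \<open>(1 - q^(L+r+1)) - q^(2r+1) (1 - q^(L-r)) = 1 - q^(2r+1)\<close>.\<close>

lemma bailey_pair_squares:
  "bailey_pair (\<lambda>r. q ^ (r * r) * (1 - q ^ (2 * r + 1))) (\<lambda>L. e L * e L)"
  unfolding bailey_pair_def
proof
  fix L
  \<comment> \<open>The explicit cutoff matters: truncated subtraction would turn
    \<open>e (L - Suc L)\<close> into \<open>e 0 = 1\<close>, whereas \<open>T (Suc L)\<close> must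
    vanish.\<close>
  define T where "T r = (if r \<le> L then q ^ (r * r) * e (L - r) * e (L + r) else 0)" for r
  have "q ^ (r * r) * (1 - q ^ (2 * r + 1)) * e (L - r) * e (L + r + 1) = T r - T (Suc r)"
    if "r \<le> L" for r
  proof (cases "r = L")
    case True
    have "(1 - q ^ Suc (L + L)) * e (Suc (L + L)) = e (L + L)" by (rule e_Suc)
    then show ?thesis
      by (simp add: True T_def e_0 mult.assoc del: power_Suc flip: mult_2)
  next
    case False
    then obtain d where L: "L = r + Suc d"
      using \<open>r \<le> L\<close> less_imp_Suc_add[of r L] by auto
    have *: "(1 - q ^ Suc (L + r)) * e (Suc (L + r)) = e (L + r)"
        "(1 - q ^ Suc d) * e (Suc d) = e d" by (rule e_Suc)+
    have p: "q ^ (Suc r * Suc r) = q ^ (r * r) * q ^ (2 * r + 1)"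
        "q ^ Suc (L + r) = q ^ (2 * r + 1) * q ^ Suc d"
      by (simp_all add: L mult_2 add_ac flip: power_add power_Suc)
    have T: "T r = q ^ (r * r) * e (Suc d) * e (L + r)"
        "T (Suc r) = q ^ (Suc r * Suc r) * e d * e (Suc (L + r))"
        "L - r = Suc d" "L + r + 1 = Suc (L + r)"
      by (simp_all add: L T_def)
    show ?thesis
      unfolding T *[symmetric] p by (simp add: algebra_simps)
  qed
  then have "(\<Sum>r\<le>L. q ^ (r * r) * (1 - q ^ (2 * r + 1)) * e (L - r) * e (L + r + 1))
      = (\<Sum>r\<le>L. T r - T (Suc r))" by simp
  also have "\<dots> = T 0 - T (Suc L)" by (rule sum_telescope)
  finally show "e L * e L = (\<Sum>r\<le>L. q ^ (r * r) * (1 - q ^ (2 * r + 1)) * e (L - r) * e (L + r + 1))"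
    by (simp add: T_def)
qed

text \<open>For \<open>L > 0\<close> the sum telescopes after multiplication by
  \<open>1 - q ^ L\<close>, since \<open>(1 - q^r)(1 - q^(L+r+1)) + q^r (1 - q^(r+1))(1 - q^(L-r)) =
  (1 - q^L)(1 - q^(2r+1))\<close>. The factor \<open>1 - q ^ r\<close> in \<open>T\<close> makes
  \<open>T 0\<close> vanish, so the total is zero, and \<open>1 - q ^ L\<close> cancels.\<close>

lemma bailey_pair_unit:
  "bailey_pair (\<lambda>r. (-1) ^ r * q ^ (r * (r - 1) div 2) * (1 - q ^ (2 * r + 1))) (\<lambda>L. if L = 0 then 1 else 0)"
  unfolding bailey_pair_def
proof
  fix L
  define \<alpha> where "\<alpha> r = (-1) ^ r * q ^ (r * (r - 1) div 2) * (1 - q ^ (2 * r + 1))" for r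
  have "(if L = 0 then 1 else 0) = (\<Sum>r\<le>L. \<alpha> r * e (L - r) * e (L + r + 1))"
  proof (cases "L = 0")
    case True
    then show ?thesis using e_Suc[of 0] by (simp add: \<alpha>_def e_0)
  next
    case False
    define T where "T r = (if r \<le> L then
      (-1) ^ r * q ^ (r * (r - 1) div 2) * (1 - q ^ r) * e (L - r) * e (L + r) else 0)" for r
    have "(1 - q ^ L) * (\<alpha> r * e (L - r) * e (L + r + 1)) = T r - T (Suc r)"
      if "r \<le> L" for r
    proof (cases "r = L")
      case True
      have "(1 - q ^ Suc (L + L)) * e (Suc (L + L)) = e (L + L)" by (rule e_Suc)
      then show ?thesis
        by (simp add: True T_def \<alpha>_def e_0 mult.left_commute[of "1 - q ^ L"] mult.assoc del: power_Suc mult_cancel_left flip: mult_2)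
    next
      case False
      then obtain d where L: "L = r + Suc d"
        using \<open>r \<le> L\<close> less_imp_Suc_add[of r L] by auto
      have *: "(1 - q ^ Suc (L + r)) * e (Suc (L + r)) = e (L + r)"
          "(1 - q ^ Suc d) * e (Suc d) = e d" by (rule e_Suc)+
      have "Suc r * r div 2 = r * (r - 1) div 2 + r"
        by (induction r) (simp_all add: algebra_simps)
      then have p: "q ^ (Suc r * (Suc r - 1) div 2) = q ^ (r * (r - 1) div 2) * q ^ r"
          "q ^ Suc (L + r) = q ^ r * q ^ r * q * q ^ Suc d" "q ^ Suc r = q * q ^ r"
          "q ^ (2 * r + 1) = q ^ r * q ^ r * q" "q ^ L = q ^ r * q ^ Suc d"
        by (simp_all add: L mult_2 mult_2_right add_ac mult_ac flip: power_add power_Suc)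
      have T: "T r = (-1) ^ r * q ^ (r * (r - 1) div 2) * (1 - q ^ r) * e (Suc d) * e (L + r)"
          "T (Suc r) = - ((-1) ^ r) * q ^ (Suc r * (Suc r - 1) div 2) * (1 - q ^ Suc r) * e d * e (Suc (L + r))"
          "L - r = Suc d" "L + r + 1 = Suc (L + r)"
        by (simp_all add: L T_def)
      show ?thesis
        unfolding T \<alpha>_def *[symmetric] p by (simp add: algebra_simps del: power_Suc)
    qed
    then have "(1 - q ^ L) * (\<Sum>r\<le>L. \<alpha> r * e (L - r) * e (L + r + 1))
      = (\<Sum>r\<le>L. T r - T (Suc r))" by (simp add: sum_distrib_left)
    also have "\<dots> = T 0 - T (Suc L)" by (rule sum_telescope)
    also have "\<dots> = 0" by (simp add: T_def)
    finally show ?thesis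
      using False not_root_of_unity[of "L - 1"] by auto
  qed
  then show "(if L = 0 then 1 else 0) = (\<Sum>r\<le>L. (-1) ^ r * q ^ (r * (r - 1) div 2) * (1 - q ^ (2 * r + 1)) *
      e (L - r) * e (L + r + 1))"
    by (simp add: \<alpha>_def)
qed

lemma bailey_step_unit: "bailey_step (\<lambda>L. if L = 0 then 1 else 0) = e"
proof
  fix L
  show "bailey_step (\<lambda>L. if L = 0 then 1 else 0) L = e L"
    unfolding bailey_step_def by (subst sum.remove[of _ 0]) (auto intro!: sum.neutral)
qed

section \<open>Iterated steps as truncated multiple sums\<close>

text \<open>Downward induction on \<open>j\<close>: the variable \<open>M\<close> of each new outer
  step becomes the tail sum from \<open>j\<close>. Then \<open>e (M - sum l {Suc j..K})\<close> is
  \<open>e (l j)\<close>, and \<open>q ^ (M * (M + 1))\<close> is the new factor in the power of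
  \<open>q\<close>. The innermost index \<open>l K\<close> carries \<open>\<beta>\<close> in place
  of \<open>e\<close>.\<close>

lemma steps_eq_multi_sum:
  assumes "j \<le> K"
  shows "(bailey_step ^^ Suc (K - j)) \<beta> L =
    (\<Sum>l | l \<in> (\<Pi>\<^sub>E s\<in>{j..K}. UNIV) \<and> sum l {j..K} \<le> L.
       e (L - sum l {j..K}) * (q ^ (\<Sum>s=j..K. sum l {s..K} * (sum l {s..K} + 1)) * (\<beta> (l K) * (\<Prod>s=j..<K. e (l s)))))"
  using assms
proof (induction j arbitrary: L rule: inc_induct)
  case base
  have "(\<Sum>l | l \<in> (\<Pi>\<^sub>E s\<in>{K..K}. UNIV) \<and> sum l {K..K} \<le> L.
       e (L - sum l {K..K}) * (q ^ (\<Sum>s=K..K. sum l {s..K} * (sum l {s..K} + 1)) * (\<beta> (l K) * (\<Prod>s=K..<K. e (l s)))))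
     = (\<Sum>M\<le>L. e (L - M) * q ^ (M * (M + 1)) * \<beta> M)"
    by (rule sum.reindex_bij_witness[of _ "\<lambda>M. \<lambda>s\<in>{K}. M" "\<lambda>l. l K"])
      (auto simp: mult_ac extensional_def PiE_def)
  then show ?case by (simp add: bailey_step_def)
next
  case (step j)
  have insert: "{j..K} = insert j {Suc j..K}" "{j..<K} = insert j {Suc j..<K}"
    using step.hyps by auto
  let ?c = "\<lambda>j l. q ^ (\<Sum>s=j..K. sum l {s..K} * (sum l {s..K} + 1)) * (\<beta> (l K) * (\<Prod>s=j..<K. e (l s)))"
  let ?I = "\<lambda>j M. {l. l \<in> (\<Pi>\<^sub>E s\<in>{j..K}. UNIV) \<and> sum l {j..K} \<le> M}"
  have "(bailey_step ^^ Suc (K - j)) \<beta> L = bailey_step ((bailey_step ^^ Suc (K - Suc j)) \<beta>) L"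
    using step.hyps by (simp flip: Suc_diff_Suc)
  also have "\<dots> = (\<Sum>M\<le>L. \<Sum>l\<in>?I (Suc j) M. e (L - M) * q ^ (M * (M + 1)) * (e (M - sum l {Suc j..K}) * ?c (Suc j) l))"
    by (simp only: bailey_step_def step.IH sum_distrib_left)
  \<comment> \<open>A pair \<open>(M, l)\<close> corresponds to the index extended at
    \<open>j\<close> by \<open>M\<close> minus the old total; conversely \<open>M\<close> is
    recovered as the new total.\<close>
  also have "\<dots> = (\<Sum>l\<in>?I j L. e (L - sum l {j..K}) * ?c j l)"
    unfolding sum.Sigma[OF finite_atMost ballI[OF finite_multi_indices_bounded]]
  proof (rule sum.reindex_bij_witness[of _ "\<lambda>l. (sum l {j..K}, restrict l {Suc j..K})" "\<lambda>(M, l). l(j := M - sum l {Suc j..K})"])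
    fix x assume "x \<in> (SIGMA M:{..L}. ?I (Suc j) M)"
    then obtain M l where x: "x = (M, l)" "M \<le> L" "l \<in> (\<Pi>\<^sub>E s\<in>{Suc j..K}. UNIV)" "sum l {Suc j..K} \<le> M"
      by auto
    define l' where "l' = l(j := M - sum l {Suc j..K})"
    have tails: "sum l' {s..K} = sum l {s..K}" if "s > j" for s
      using that by (intro sum.cong) (auto simp: l'_def)
    have "sum l' {j..K} = l' j + sum l' {Suc j..K}"
      unfolding insert by (subst sum.insert) auto
    also have "\<dots> = M"
      using x(4) tails[of "Suc j"] by (simp add: l'_def)
    finally have M: "sum l' {j..K} = M" .
    have "l' \<in> (\<Pi>\<^sub>E s\<in>{j..K}. UNIV)"
      using x(3) step.hyps by (auto simp: l'_def PiE_def extensional_def)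
    then show "(case x of (M, l) \<Rightarrow> l(j := M - sum l {Suc j..K})) \<in> ?I j L"
      unfolding x(1) prod.case l'_def[symmetric] using M x(2) by blast
    have "restrict l' {Suc j..K} = l"
      using x(3) by (auto simp: l'_def PiE_def extensional_def fun_eq_iff)
    then show "(sum (case x of (M, l) \<Rightarrow> l(j := M - sum l {Suc j..K})) {j..K},
        restrict (case x of (M, l) \<Rightarrow> l(j := M - sum l {Suc j..K})) {Suc j..K}) = x"
      unfolding x(1) prod.case l'_def[symmetric] M by (rule arg_cong)
    have "(\<Sum>s=j..K. sum l' {s..K} * (sum l' {s..K} + 1)) = M * (M + 1) + (\<Sum>s=Suc j..K. sum l {s..K} * (sum l {s..K} + 1))"
      using M step.hyps tails by (simp add: sum.atLeast_Suc_atMost[of j K])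
    moreover have "(\<Prod>s=j..<K. e (l' s)) = e (M - sum l {Suc j..K}) * (\<Prod>s=Suc j..<K. e (l s))"
      unfolding insert by (subst prod.insert) (auto simp: l'_def intro!: prod.cong)
    moreover have "l' K = l K" using step.hyps by (simp add: l'_def)
    ultimately have "e (L - sum l' {j..K}) * ?c j l' = e (L - M) * q ^ (M * (M + 1)) * (e (M - sum l {Suc j..K}) * ?c (Suc j) l)"
      using M by (simp only: power_add mult_ac)
    then show "e (L - sum (case x of (M, l) \<Rightarrow> l(j := M - sum l {Suc j..K})) {j..K}) * ?c j (case x of (M, l) \<Rightarrow> l(j := M - sum l {Suc j..K}))
       = (case x of (M, l) \<Rightarrow> e (L - M) * q ^ (M * (M + 1)) * (e (M - sum l {Suc j..K}) * ?c (Suc j) l))"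
      unfolding x(1) prod.case l'_def[symmetric] .
  next
    fix l assume l: "l \<in> ?I j L"
    define l' where "l' = restrict l {Suc j..K}"
    have l': "sum l' {Suc j..K} = sum l {Suc j..K}"
      by (simp add: l'_def)
    have s: "sum l {j..K} = l j + sum l {Suc j..K}" by (simp add: insert)
    show "(sum l {j..K}, restrict l {Suc j..K}) \<in> (SIGMA M:{..L}. ?I (Suc j) M)"
      using l s by auto
    have "l'(j := l j) = l"
      using l by (auto simp: l'_def PiE_def extensional_def fun_eq_iff insert)
    then show "(case (sum l {j..K}, restrict l {Suc j..K}) of (M, l) \<Rightarrow> l(j := M - sum l {Suc j..K})) = l"
      unfolding prod.case l'_def[symmetric] l' s by simp
  qed
  finally show ?case .
qed

end

subsection \<open>Formal power series modulo \<open>X\<^sup>N\<close>\<close>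

definition fps_cong :: "nat \<Rightarrow> 'a::zero fps \<Rightarrow> 'a fps \<Rightarrow> bool" where
  "fps_cong N f g \<longleftrightarrow> (\<forall>n<N. fps_nth f n = fps_nth g n)"

lemma fps_cong_refl [simp]: "fps_cong N f f"
  by (simp add: fps_cong_def)

lemma fps_cong_sym: "fps_cong N f g \<Longrightarrow> fps_cong N g f"
  by (simp add: fps_cong_def)

lemma fps_cong_trans [trans]: "fps_cong N f g \<Longrightarrow> fps_cong N g h \<Longrightarrow> fps_cong N f h"
  by (simp add: fps_cong_def)

lemma fps_cong_mono: "fps_cong N f g \<Longrightarrow> M \<le> N \<Longrightarrow> fps_cong M f g"
  by (simp add: fps_cong_def)

lemma fps_eq_if_cong: "(\<And>N. fps_cong N f g) \<Longrightarrow> f = g"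
  unfolding fps_cong_def by (intro fps_ext) blast

lemma fps_cong_add:
  fixes f f' g g' :: "'a::monoid_add fps"
  shows "fps_cong N f f' \<Longrightarrow> fps_cong N g g' \<Longrightarrow> fps_cong N (f + g) (f' + g')"
  by (simp add: fps_cong_def)

lemma fps_cong_diff:
  fixes f f' g g' :: "'a::group_add fps"
  shows "fps_cong N f f' \<Longrightarrow> fps_cong N g g' \<Longrightarrow> fps_cong N (f - g) (f' - g')"
  by (simp add: fps_cong_def)

lemma fps_cong_mult:
  fixes f f' g g' :: "'a::comm_semiring_1 fps"
  shows "fps_cong N f f' \<Longrightarrow> fps_cong N g g' \<Longrightarrow> fps_cong N (f * g) (f' * g')"
  by (auto simp: fps_cong_def fps_mult_nth intro!: sum.cong)

lemma fps_cong_sum: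
  fixes f g :: "'b \<Rightarrow> 'a::comm_monoid_add fps"
  shows "(\<And>x. x \<in> A \<Longrightarrow> fps_cong N (f x) (g x)) \<Longrightarrow> fps_cong N (sum f A) (sum g A)"
  by (simp add: fps_cong_def fps_sum_nth)

lemma fps_cong_0_mult:
  fixes f g :: "'a::comm_semiring_1 fps"
  assumes "fps_cong N f 0"
  shows "fps_cong N (f * g) 0" "fps_cong N (g * f) 0"
  using fps_cong_mult[OF assms fps_cong_refl[of N g]] fps_cong_mult[OF fps_cong_refl[of N g] assms]
  by simp_all

lemma fps_cong_X_power: "N \<le> n \<Longrightarrow> fps_cong N (fps_X ^ n :: 'a::comm_ring_1 fps) 0"
  by (simp add: fps_cong_def fps_X_power_nth)

text \<open>A finite counterpart of dominated convergence: terms in \<open>B\<close> are replaced by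
  their limits, the others are negligible modulo \<open>X^N\<close>.\<close>

lemma fps_cong_sum_truncate:
  fixes f g :: "'b \<Rightarrow> 'a::comm_ring_1 fps"
  assumes "finite A" "B \<subseteq> A"
    and "\<And>x. x \<in> B \<Longrightarrow> fps_cong N (f x) (g x)" "\<And>x. x \<in> A - B \<Longrightarrow> fps_cong N (f x) 0"
  shows "fps_cong N (sum f A) (sum g B)"
proof -
  have "sum f A = sum f B + sum f (A - B)"
    using sum.subset_diff[OF assms(2,1)] by (simp add: add.commute)
  moreover have "fps_cong N (sum f (A - B)) (\<Sum>x\<in>A - B. 0)"
    using assms by (intro fps_cong_sum) auto
  moreover have "fps_cong N (sum f B) (sum g B)"
    using assms by (intro fps_cong_sum)
  ultimately show ?thesis
    using fps_cong_add[of N "sum f B" "sum g B" "sum f (A - B)" 0] by simp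
qed

section \<open>Convergence of sums whose terms have growing order\<close>

text \<open>Only the finitely many terms with \<open>h x \<le> n\<close> can affect coefficient
  \<open>n\<close>, so it is constant on all finite partial sums containing them; this is
  convergence in the topology of \<open>fps\<close>.\<close>

lemma fps_graded_summable:
  fixes f :: "'b \<Rightarrow> 'a::comm_ring_1 fps" and h :: "'b \<Rightarrow> nat"
  assumes cong: "\<And>x. x \<in> A \<Longrightarrow> fps_cong (h x) (f x) 0"
    and fin: "\<And>N. finite {x\<in>A. h x < N}"
  shows "f summable_on A" "fps_cong N (infsum f A) (\<Sum>x | x \<in> A \<and> h x < N. f x)"
proof -
  let ?B = "\<lambda>N. {x\<in>A. h x < N}"
  define s where "s = Abs_fps (\<lambda>n. fps_nth (sum f (?B (Suc n))) n)"
  have stable: "fps_nth (sum f F) n = fps_nth s n" if "finite F" "?B (Suc n) \<subseteq> F" "F \<subseteq> A" for F n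
  proof -
    have "fps_cong (Suc n) (sum f F) (sum f (?B (Suc n)))"
      using that by (intro fps_cong_sum_truncate fps_cong_mono[OF cong]) auto
    then show ?thesis by (simp add: fps_cong_def s_def)
  qed
  have "(f has_sum s) A"
    unfolding has_sum_def
  proof (rule tendsto_fpsI)
    show "\<forall>\<^sub>F F in finite_subsets_at_top A. fps_nth (sum f F) n = fps_nth s n" for n
      unfolding eventually_finite_subsets_at_top
      using fin[of "Suc n"] stable by (intro exI[of _ "?B (Suc n)"]) auto
  qed
  then show "f summable_on A"
    by (rule has_sum_imp_summable)
  have "infsum f A = s"
    by (rule infsumI) fact
  moreover have "fps_nth (sum f (?B N)) n = fps_nth s n" if "n < N" for n
    using that by (intro stable fin) auto
  ultimately show "fps_cong N (infsum f A) (sum f (?B N))"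
    by (simp add: fps_cong_def)
qed

lemma fps_graded_summable_nat:
  fixes f :: "nat \<Rightarrow> 'a::comm_ring_1 fps"
  assumes "\<And>i. i \<ge> m \<Longrightarrow> fps_cong i (f i) 0"
  shows "f summable_on {m..}" "fps_cong N (infsum f {m..}) (\<Sum>i<N. f (i + m))"
proof -
  have *: "fps_cong i (f i) 0" if "i \<in> {m..}" for i using assms that by simp
  have fin: "finite {i\<in>{m..}. i < N}" for N by simp
  show "f summable_on {m..}" using fps_graded_summable(1)[OF * fin] by simp
  \<comment> \<open>The added terms have \<open>i \<ge> N\<close> and vanish modulo
    \<open>X^N\<close>; exactly \<open>N\<close> terms remain whatever \<open>m\<close> is.\<close>
  have "fps_cong N (\<Sum>i | i \<in> {m..} \<and> i < N. f i) (\<Sum>i\<in>{m..<N + m}. f i)"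
    using assms by (intro fps_cong_sym[OF fps_cong_sum_truncate] fps_cong_mono[OF assms]) auto
  also have "(\<Sum>i\<in>{m..<N + m}. f i) = (\<Sum>i<N. f (i + m))"
    using sum.shift_bounds_nat_ivl[of f 0 m N] by (simp add: atLeast0LessThan)
  finally show "fps_cong N (infsum f {m..}) (\<Sum>i<N. f (i + m))"
    using fps_cong_trans[OF fps_graded_summable(2)[OF * fin]] by blast
qed

subsection \<open>The Bailey chain in formal power series\<close>

definition rqpoch :: "nat \<Rightarrow> 'a::field fps" where
  "rqpoch n = inverse (qpoch fps_X fps_X n)"

lemma qpoch_fps_X_nth_0: "fps_nth (qpoch fps_X fps_X n :: 'a::field fps) 0 = 1"
  by (induction n) (simp_all add: qpoch_def)

lemma rqpoch_mult_qpoch: "rqpoch n * qpoch fps_X fps_X n = (1 :: 'a::field fps)"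
  unfolding rqpoch_def by (rule inverse_mult_eq_1) (simp add: qpoch_fps_X_nth_0)

interpretation qfps: q_reciprocals "fps_X :: 'a::field fps" rqpoch
proof
  fix n
  show "rqpoch 0 = (1 :: 'a fps)"
    by (simp add: rqpoch_def qpoch_def)
  have nth_0: "fps_nth (1 - fps_X ^ Suc n :: 'a fps) 0 = 1"
    by simp
  then show "1 - fps_X ^ Suc n \<noteq> (0 :: 'a fps)"
    by force
  have "rqpoch (Suc n) = rqpoch n * inverse (1 - fps_X ^ Suc n :: 'a fps)"
    by (simp add: rqpoch_def qpoch_def fps_inverse_mult)
  then show "(1 - fps_X ^ Suc n) * rqpoch (Suc n) = (rqpoch n :: 'a fps)"
    using inverse_mult_eq_1[of "1 - fps_X ^ Suc n :: 'a fps"] nth_0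
    by (simp add: mult.left_commute mult.commute[of _ "inverse _"] del: power_Suc)
qed

text \<open>Every factor beyond the first \<open>N\<close> is congruent to 1 modulo
  \<open>X^N\<close>.\<close>

lemma qpoch_cong:
  assumes "N \<le> n"
  shows "fps_cong N (qpoch fps_X fps_X n :: 'a::field fps) (qpoch fps_X fps_X N)"
  using assms
proof (induction n rule: dec_induct)
  case (step n)
  have "qpoch fps_X fps_X (Suc n) = qpoch fps_X fps_X n - qpoch fps_X fps_X n * (fps_X ^ Suc n :: 'a fps)"
    by (simp add: qpoch_def algebra_simps)
  moreover have "fps_cong N (qpoch fps_X fps_X n - qpoch fps_X fps_X n * (fps_X ^ Suc n :: 'a fps))
      (qpoch fps_X fps_X N - 0)"
    using step by (intro fps_cong_diff fps_cong_0_mult(2) fps_cong_X_power) auto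
  ultimately show ?case by simp
qed simp

lemma qpoch_inf_cong:
  assumes "N \<le> n"
  shows "fps_cong N (qpoch_inf fps_X fps_X) (qpoch fps_X fps_X n :: 'a::field fps)"
proof -
  let ?f = "\<lambda>j. 1 - fps_X * fps_X ^ j :: 'a fps"
  have nz: "?f j \<noteq> 0" for j
    using qfps.not_root_of_unity[of j] by simp
  \<comment> \<open>\<open>has_prod\<close> also admits products with a zero factor; as no factor
    vanishes, the partial products from index 0 converge to the value.\<close>
  have "raw_has_prod ?f 0 (qpoch_inf fps_X fps_X)"
    using qpoch_inf_fps_X[where 'a='a] nz unfolding has_prod_def by blast
  then have lim: "(\<lambda>n. \<Prod>j\<le>n. ?f j) \<longlonglongrightarrow> qpoch_inf fps_X fps_X"
    by (simp add: raw_has_prod_def)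
  show ?thesis
    unfolding fps_cong_def
  proof (intro allI impI)
    fix m assume m: "m < N"
    have "\<forall>\<^sub>F n in sequentially. fps_nth (\<Prod>j\<le>n. ?f j) m = fps_nth (qpoch_inf fps_X fps_X) m"
      using lim by (simp add: tendsto_fps_iff)
    then obtain n0 where "\<forall>n'\<ge>n0. fps_nth (\<Prod>j\<le>n'. ?f j) m = fps_nth (qpoch_inf fps_X fps_X) m"
      by (auto simp: eventually_sequentially)
    then have "fps_nth (qpoch_inf fps_X fps_X) m = fps_nth (\<Prod>j\<le>max n0 N. ?f j) m"
      by simp
    also have "(\<Prod>j\<le>max n0 N. ?f j) = qpoch fps_X fps_X (Suc (max n0 N))"
      by (simp only: qpoch_def lessThan_Suc_atMost)
    also have "fps_nth \<dots> m = fps_nth (qpoch fps_X fps_X N) m"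
      using qpoch_cong[of N "Suc (max n0 N)", where 'a='a] m by (simp add: fps_cong_def)
    also have "\<dots> = fps_nth (qpoch fps_X fps_X n) m"
      using qpoch_cong[OF assms, where 'a='a] m by (simp add: fps_cong_def)
    finally show "fps_nth (qpoch_inf fps_X fps_X) m = fps_nth (qpoch fps_X fps_X n :: 'a fps) m" .
  qed
qed

lemma qpoch_inf_mult_rqpoch:
  assumes "N \<le> n"
  shows "fps_cong N (qpoch_inf fps_X fps_X * rqpoch n :: 'a::field fps) 1"
  using fps_cong_mult[OF qpoch_inf_cong[OF assms, where 'a='a] fps_cong_refl[of N "rqpoch n"]]
  by (simp add: rqpoch_mult_qpoch mult.commute)

text \<open>Multiply the Bailey relation by \<open>(q;q)_\<infinity>\<close> twice. One factor is
  absorbed by \<open>S\<close>, the limit of \<open>(q;q)_\<infinity> \<beta> L\<close>; on the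
  other side each reciprocal takes one factor and tends to 1, which leaves the sum of the
  \<open>\<alpha> r\<close>.\<close>

lemma bailey_pair_limit:
  fixes \<alpha> \<beta> :: "nat \<Rightarrow> 'a::field fps"
  assumes pair: "qfps.bailey_pair \<alpha> \<beta>"
    and \<alpha>: "\<And>r. fps_cong r (\<alpha> r) 0"
    and S: "fps_cong N (qpoch_inf fps_X fps_X * \<beta> (2 * N)) S"
  shows "fps_cong N (qpoch_inf fps_X fps_X * S) (\<Sum>r<N. \<alpha> r)"
proof -
  \<comment> \<open>For \<open>r < N\<close> this makes both \<open>?L - r\<close> and
    \<open>?L + r + 1\<close> at least \<open>N\<close>, so both reciprocals are already at their
    limit modulo \<open>X^N\<close>.\<close>
  let ?P = "qpoch_inf fps_X fps_X :: 'a fps" and ?L = "2 * N"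
  have "fps_cong N (?P * S) (?P * (?P * \<beta> ?L))"
    using S by (intro fps_cong_mult fps_cong_refl) (rule fps_cong_sym)
  also have "?P * (?P * \<beta> ?L) = (\<Sum>r\<le>?L. \<alpha> r * ((?P * rqpoch (?L - r)) * (?P * rqpoch (?L + r + 1))))"
    using pair by (simp add: qfps.bailey_pair_def sum_distrib_left mult_ac)
  also have "fps_cong N \<dots> (\<Sum>r<N. \<alpha> r * (1 * 1))"
  proof (rule fps_cong_sum_truncate)
    show "fps_cong N (\<alpha> r * ((?P * rqpoch (?L - r)) * (?P * rqpoch (?L + r + 1)))) (\<alpha> r * (1 * 1))"
      if "r \<in> {..<N}" for r
      using that by (intro fps_cong_mult fps_cong_refl qpoch_inf_mult_rqpoch) auto
    show "fps_cong N (\<alpha> r * ((?P * rqpoch (?L - r)) * (?P * rqpoch (?L + r + 1)))) 0"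
      if "r \<in> {..?L} - {..<N}" for r
      using that by (intro fps_cong_0_mult(1) fps_cong_mono[OF \<alpha>]) auto
  qed auto
  finally show ?thesis by simp
qed

text \<open>After \<open>K\<close> steps \<open>\<beta>\<close> is the truncated multiple sum with
  the extra factor \<open>rqpoch (2 * N - sum l {1..K})\<close>. Times
  \<open>(q;q)_\<infinity>\<close>, that factor is 1 modulo \<open>X^N\<close> when the total of
  \<open>l\<close> is below \<open>N\<close>; otherwise \<open>c l\<close> itself vanishes.\<close>

lemma bailey_chain_multi_sum:
  fixes \<alpha> \<beta> :: "nat \<Rightarrow> 'a::field fps" and K :: nat
  defines "c \<equiv> \<lambda>l. fps_X ^ (\<Sum>s=1..K. sum l {s..K} * (sum l {s..K} + 1)) * (\<beta> (l K) * (\<Prod>s=1..<K. rqpoch (l s)))"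
  assumes pair: "qfps.bailey_pair \<alpha> \<beta>" and K: "1 \<le> K"
  shows "c summable_on (\<Pi>\<^sub>E s\<in>{1..K}. UNIV)"
    and "fps_cong N (qpoch_inf fps_X fps_X * infsum c (\<Pi>\<^sub>E s\<in>{1..K}. UNIV))
           (\<Sum>r<N. fps_X ^ (K * (r * (r + 1))) * \<alpha> r)"
proof -
  let ?P = "qpoch_inf fps_X fps_X :: 'a fps"
  let ?A = "(\<Pi>\<^sub>E s\<in>{1..K}. UNIV) :: (nat \<Rightarrow> nat) set"
  \<comment> \<open>The \<open>s = 1\<close> summand of the exponent alone is at least the total of
    \<open>l\<close>.\<close>
  have c: "fps_cong (sum l {1..K}) (c l) 0" for l
  proof -
    have "sum l {1..K} \<le> sum l {1..K} * (sum l {1..K} + 1)" by simp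
    also have "\<dots> \<le> (\<Sum>s=1..K. sum l {s..K} * (sum l {s..K} + 1))"
      using K by (intro member_le_sum[where f = "\<lambda>s. sum l {s..K} * (sum l {s..K} + 1)"]) auto
    finally show ?thesis
      unfolding c_def by (intro fps_cong_0_mult(1) fps_cong_X_power)
  qed
  have fin: "finite {l \<in> ?A. sum l {1..K} < M}" for M
    by (rule finite_subset[OF _ finite_multi_indices_bounded[of 1 K M]]) auto
  note summable = fps_graded_summable[where f = c and A = ?A and h = "\<lambda>l. sum l {1..K}", OF c fin]
  show "c summable_on ?A"
    by (rule summable)
  have eq: "?P * (qfps.bailey_step ^^ K) \<beta> (2 * N) =
      (\<Sum>l | l \<in> ?A \<and> sum l {1..K} \<le> 2 * N. (?P * rqpoch (2 * N - sum l {1..K})) * c l)"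
  proof -
    have "Suc (K - 1) = K" using K by simp
    then show ?thesis
      using qfps.steps_eq_multi_sum[OF K, of \<beta> "2 * N"]
      by (simp only: c_def sum_distrib_left[of ?P] mult.assoc)
  qed
  have "fps_cong N (?P * (qfps.bailey_step ^^ K) \<beta> (2 * N)) (\<Sum>l | l \<in> ?A \<and> sum l {1..K} < N. 1 * c l)"
    unfolding eq
  proof (rule fps_cong_sum_truncate)
    show "finite {l. l \<in> ?A \<and> sum l {1..K} \<le> 2 * N}"
      by (rule finite_multi_indices_bounded)
    show "fps_cong N (?P * rqpoch (2 * N - sum l {1..K}) * c l) (1 * c l)"
      if "l \<in> {l. l \<in> ?A \<and> sum l {1..K} < N}" for l
      using that by (intro fps_cong_mult fps_cong_refl qpoch_inf_mult_rqpoch) auto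
    show "fps_cong N (?P * rqpoch (2 * N - sum l {1..K}) * c l) 0"
      if "l \<in> {l. l \<in> ?A \<and> sum l {1..K} \<le> 2 * N} - {l. l \<in> ?A \<and> sum l {1..K} < N}" for l
      using that by (intro fps_cong_0_mult(2) fps_cong_mono[OF c]) auto
  qed auto
  also have "fps_cong N \<dots> (infsum c ?A)"
    unfolding mult_1_left by (rule fps_cong_sym[OF summable(2)])
  finally have lim: "fps_cong N (?P * (qfps.bailey_step ^^ K) \<beta> (2 * N)) (infsum c ?A)" .
  show "fps_cong N (?P * infsum c ?A) (\<Sum>r<N. fps_X ^ (K * (r * (r + 1))) * \<alpha> r)"
  proof (rule bailey_pair_limit[where \<beta> = "(qfps.bailey_step ^^ K) \<beta>"])
    show "qfps.bailey_pair (\<lambda>r. fps_X ^ (K * (r * (r + 1))) * \<alpha> r) ((qfps.bailey_step ^^ K) \<beta>)"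
      by (rule qfps.bailey_pair_steps[OF pair])
    show "fps_cong r (fps_X ^ (K * (r * (r + 1))) * \<alpha> r) 0" for r
    proof -
      have "r * 1 \<le> K * (r * (r + 1))"
        using mult_le_mono[OF K, of "r * 1" "r * (r + 1)"] by simp
      then show ?thesis
        by (intro fps_cong_0_mult(1) fps_cong_X_power) simp
    qed
  qed (fact lim)
qed

section \<open>From the chain to the stated identities\<close>

lemma fps_divide_eq_mult:
  fixes f g h :: "'a::field fps"
  assumes "h * g = 1"
  shows "f / g = f * h"
proof -
  have "g \<noteq> 0" using assms by auto
  moreover have "f = (f * h) * g" using assms by (simp add: mult.assoc)
  ultimately show ?thesis by (metis nonzero_mult_div_cancel_right)
qed

lemma prod_rqpoch_mult_prod_qpoch:
  "(\<Prod>s\<in>A. rqpoch (l s)) * (\<Prod>s\<in>A. qpoch fps_X fps_X (l s)) = (1 :: 'a::field fps)"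
  by (simp add: rqpoch_mult_qpoch flip: prod.distrib)

text \<open>The factor \<open>1 - X^(2r+1)\<close> of \<open>\<alpha> r\<close> yields two
  monomials; one is term \<open>r\<close> of the first series, the other term \<open>r + 1\<close>
  of the second.\<close>

lemma infsum_add_infsum_eqI:
  fixes a b :: "nat \<Rightarrow> 'a::comm_ring_1 fps"
  assumes a: "\<And>i. fps_cong i (a i) 0" and b: "\<And>i. i \<ge> 1 \<Longrightarrow> fps_cong i (b i) 0"
    and S: "\<And>N. fps_cong N S (\<Sum>r<N. a r + b (r + 1))"
  shows "infsum a UNIV + infsum b {1..} = S"
proof (rule fps_eq_if_cong)
  fix N
  have "fps_cong N (infsum a UNIV + infsum b {1..}) ((\<Sum>i<N. a i) + (\<Sum>i<N. b (i + 1)))"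
    using fps_graded_summable_nat(2)[of 0 a N] a fps_graded_summable_nat(2)[of 1 b N] b
    by (intro fps_cong_add) (simp_all add: atLeast_0)
  also have "fps_cong N \<dots> S"
    using fps_cong_sym[OF S] by (simp only: sum.distrib)
  finally show "fps_cong N (infsum a UNIV + infsum b {1..}) S" .
qed

lemma infsum_uminus_fps:
  fixes b :: "nat \<Rightarrow> 'a::field fps"
  assumes b: "\<And>i. i \<ge> m \<Longrightarrow> fps_cong i (b i) 0"
  shows "infsum (\<lambda>i. - b i) {m..} = - infsum b {m..}"
proof (rule fps_eq_if_cong)
  fix N
  have "fps_cong N (infsum (\<lambda>i. - b i) {m..}) (\<Sum>i<N. - b (i + m))"
    using b by (intro fps_graded_summable_nat(2)) (simp add: fps_cong_def)
  then show "fps_cong N (infsum (\<lambda>i. - b i) {m..}) (- infsum b {m..})"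
    using fps_graded_summable_nat(2)[of m b N] b by (simp add: fps_cong_def sum_negf)
qed

theorem theorem6p10:
  fixes q :: "'a::field fps"
  defines "q \<equiv> fps_X"
  shows
    "(\<forall>k::nat. k \<ge> 2 \<longrightarrow>
      (let a = (\<lambda>i::nat. q ^ (k * i^2 + (k - 1) * i));
           b = (\<lambda>i::nat. q ^ (k * (i^2 - i) + i));
           c = (\<lambda>l. q ^ (\<Sum>j=1..k-1. tail_sum k l j * (tail_sum k l j + 1)) /
                  ((qpoch q q (l (k - 1)))^2 * (\<Prod>j=1..k-2. qpoch q q (l j))))
       in a summable_on UNIV \<and> b summable_on {1..} \<and> c summable_on multi_indices k \<and>
          (\<Sum>\<^sub>\<infinity>i. a i) - (\<Sum>\<^sub>\<infinity>i\<in>{1..}. b i) =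
            qpoch_inf q q * (\<Sum>\<^sub>\<infinity>l\<in>multi_indices k. c l)))
    \<and>
    (\<forall>k::nat. k \<ge> 1 \<longrightarrow>
      (let a = (\<lambda>i::nat. (-1) ^ i * q ^ (k * (i^2 + i)) * q ^ (i * (i - 1) div 2));
           b = (\<lambda>i::nat. (-1) ^ i * q ^ (k * (i^2 - i)) * q ^ (i * (i + 1) div 2));
           c = (\<lambda>l. q ^ (\<Sum>j=1..k-1. tail_sum k l j * (tail_sum k l j + 1)) /
                  (\<Prod>j=1..k-1. qpoch q q (l j)))
       in a summable_on UNIV \<and> b summable_on {1..} \<and> c summable_on multi_indices k \<and>
          (\<Sum>\<^sub>\<infinity>i. a i) + (\<Sum>\<^sub>\<infinity>i\<in>{1..}. b i) =
            qpoch_inf q q * (\<Sum>\<^sub>\<infinity>l\<in>multi_indices k. c l)))"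
proof (intro conjI allI impI)
  fix k :: nat
  assume k: "k \<ge> 2"
  define K where "K = k - 1"
  have K: "1 \<le> K" and k_eq: "k = Suc K" using k by (simp_all add: K_def)
  define a where "a i = (fps_X ^ (k * i\<^sup>2 + (k - 1) * i) :: 'a fps)" for i :: nat
  define b where "b i = (fps_X ^ (k * (i\<^sup>2 - i) + i) :: 'a fps)" for i :: nat
  define c where "c l = (fps_X ^ (\<Sum>j=1..k-1. tail_sum k l j * (tail_sum k l j + 1)) /
      ((qpoch fps_X fps_X (l (k - 1)))^2 * (\<Prod>j=1..k-2. qpoch fps_X fps_X (l j))) :: 'a fps)" for l
  have a: "fps_cong i (a i) 0" for i
    unfolding a_def using le_square[of i]
    by (intro fps_cong_X_power) (simp add: k_eq power2_eq_square trans_le_add1)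
  have b: "fps_cong i (b i) 0" for i
    unfolding b_def by (rule fps_cong_X_power) simp
  \<comment> \<open>The exponents are \<open>K r(r+1) + r^2\<close> and
    \<open>K r(r+1) + (r+1)^2\<close>, those of \<open>a r\<close> and
    \<open>b (r + 1)\<close>.\<close>
  have ab: "fps_X ^ (K * (r * (r + 1))) * (fps_X ^ (r * r) * (1 - fps_X ^ (2 * r + 1))) = a r + - b (r + 1)" for r
  proof -
    have "k * r\<^sup>2 + (k - 1) * r = K * (r * (r + 1)) + r * r"
      by (simp add: k_eq power2_eq_square algebra_simps)
    moreover have "k * ((r + 1)\<^sup>2 - (r + 1)) + (r + 1) = K * (r * (r + 1)) + r * r + (2 * r + 1)"
      by (simp add: k_eq power2_eq_square algebra_simps)
    ultimately show ?thesis
      unfolding a_def b_def by (simp only: power_add) (simp add: algebra_simps)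
  qed
  \<comment> \<open>The squared denominator at \<open>l (k - 1)\<close> is the initial
    \<open>\<beta>\<close> evaluated at the innermost index.\<close>
  have c: "c = (\<lambda>l. fps_X ^ (\<Sum>s=1..K. sum l {s..K} * (sum l {s..K} + 1)) *
      ((rqpoch (l K) * rqpoch (l K)) * (\<Prod>s=1..<K. rqpoch (l s))))"
  proof
    fix l
    have "{1..k-2} = {1..<K}" using k by (auto simp: K_def)
    moreover have "(rqpoch (l K) * rqpoch (l K)) * (\<Prod>s=1..<K. rqpoch (l s)) *
        ((qpoch fps_X fps_X (l K))\<^sup>2 * (\<Prod>s=1..<K. qpoch fps_X fps_X (l s))) =
        (rqpoch (l K) * qpoch fps_X fps_X (l K)) * (rqpoch (l K) * qpoch fps_X fps_X (l K)) *
        ((\<Prod>s=1..<K. rqpoch (l s)) * (\<Prod>s=1..<K. qpoch fps_X fps_X (l s)) :: 'a fps)"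
      by (simp only: power2_eq_square mult_ac)
    ultimately show "c l = fps_X ^ (\<Sum>s=1..K. sum l {s..K} * (sum l {s..K} + 1)) *
        ((rqpoch (l K) * rqpoch (l K)) * (\<Prod>s=1..<K. rqpoch (l s)))"
      unfolding c_def tail_sum_def K_def[symmetric]
      by (subst fps_divide_eq_mult) (simp_all only: rqpoch_mult_qpoch prod_rqpoch_mult_prod_qpoch mult_1_left)
  qed
  have idx: "multi_indices k = (\<Pi>\<^sub>E s\<in>{1..K}. UNIV)"
    by (simp add: multi_indices_def K_def)
  have pair: "qfps.bailey_pair (\<lambda>r. fps_X ^ (r * r) * (1 - fps_X ^ (2 * r + 1)) :: 'a fps) (\<lambda>L. rqpoch L * rqpoch L)"
    by (rule qfps.bailey_pair_squares)
  have "a summable_on UNIV"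
    using fps_graded_summable_nat(1)[of 0 a] a by (simp add: atLeast_0)
  moreover have "b summable_on {1..}"
    using b by (intro fps_graded_summable_nat(1))
  moreover have "c summable_on multi_indices k"
    unfolding c idx by (rule bailey_chain_multi_sum(1)[OF pair K])
  moreover have "infsum a UNIV + infsum (\<lambda>i. - b i) {1..} = qpoch_inf fps_X fps_X * infsum c (multi_indices k)"
    unfolding c idx
  proof (rule infsum_add_infsum_eqI[OF a])
    show "fps_cong i (- b i) 0" for i using b[of i] by (simp add: fps_cong_def)
  qed (rule bailey_chain_multi_sum(2)[OF pair K, unfolded ab])
  moreover have "infsum (\<lambda>i. - b i) {1..} = - infsum b {1..}"
    using b by (rule infsum_uminus_fps)
  ultimately show "let a = (\<lambda>i::nat. q ^ (k * i^2 + (k - 1) * i));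
           b = (\<lambda>i::nat. q ^ (k * (i^2 - i) + i));
           c = (\<lambda>l. q ^ (\<Sum>j=1..k-1. tail_sum k l j * (tail_sum k l j + 1)) /
                  ((qpoch q q (l (k - 1)))^2 * (\<Prod>j=1..k-2. qpoch q q (l j))))
       in a summable_on UNIV \<and> b summable_on {1..} \<and> c summable_on multi_indices k \<and>
          (\<Sum>\<^sub>\<infinity>i. a i) - (\<Sum>\<^sub>\<infinity>i\<in>{1..}. b i) =
            qpoch_inf q q * (\<Sum>\<^sub>\<infinity>l\<in>multi_indices k. c l)"
    unfolding Let_def q_def a_def[abs_def, symmetric] b_def[abs_def, symmetric] c_def[abs_def, symmetric]
    by simp
next
  fix k :: nat
  assume k: "k \<ge> 1"
  define K where "K = k - 1"
  have k_eq: "k = Suc K" using k by (simp add: K_def)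
  define a where "a i = ((-1) ^ i * fps_X ^ (k * (i\<^sup>2 + i)) * fps_X ^ (i * (i - 1) div 2) :: 'a fps)" for i :: nat
  define b where "b i = ((-1) ^ i * fps_X ^ (k * (i\<^sup>2 - i)) * fps_X ^ (i * (i + 1) div 2) :: 'a fps)" for i :: nat
  define c where "c l = (fps_X ^ (\<Sum>j=1..k-1. tail_sum k l j * (tail_sum k l j + 1)) /
      (\<Prod>j=1..k-1. qpoch fps_X fps_X (l j)) :: 'a fps)" for l
  have a: "fps_cong i (a i) 0" for i
    unfolding a_def using k by (intro fps_cong_0_mult(1) fps_cong_0_mult(2) fps_cong_X_power) (simp add: k_eq power2_eq_square trans_le_add1)
  have b: "fps_cong i (b i) 0" for i
  proof -
    have "i * 2 \<le> i * (i + 1)" by (cases i) simp_all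
    then have "i \<le> i * (i + 1) div 2" by linarith
    then show ?thesis
      unfolding b_def by (intro fps_cong_0_mult(2) fps_cong_X_power)
  qed
  let ?\<alpha> = "\<lambda>r. (-1) ^ r * fps_X ^ (r * (r - 1) div 2) * (1 - fps_X ^ (2 * r + 1)) :: 'a fps"
  \<comment> \<open>The step already contained in the initial pair raises \<open>K\<close> to
    \<open>k\<close> in the exponent. The sign of \<open>b (r + 1)\<close> absorbs the minus of
    \<open>1 - X^(2r+1)\<close>, and \<open>(r+1)(r+2)/2 = r(r-1)/2 + 2r + 1\<close>.\<close>
  have ab: "fps_X ^ (K * (r * (r + 1))) * (fps_X ^ (r * (r + 1)) * ?\<alpha> r) = a r + b (r + 1)" for r
  proof -
    have "Suc (Suc r) * Suc r div 2 = r * (r - 1) div 2 + (2 * r + 1)"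
      by (induction r) (simp_all add: algebra_simps)
    then have "(r + 1) * (r + 1 + 1) div 2 = r * (r - 1) div 2 + (2 * r + 1)"
      by (simp add: mult.commute)
    moreover have "k * (r\<^sup>2 + r) = K * (r * (r + 1)) + r * (r + 1)"
        "k * ((r + 1)\<^sup>2 - (r + 1)) = K * (r * (r + 1)) + r * (r + 1)"
      by (simp_all add: k_eq power2_eq_square algebra_simps)
    ultimately show ?thesis
      unfolding a_def b_def by (simp only: power_add) (simp add: algebra_simps)
  qed
  have c: "c = (\<lambda>l. fps_X ^ (\<Sum>s=1..K. sum l {s..K} * (sum l {s..K} + 1)) * (\<Prod>s=1..K. rqpoch (l s)))"
    unfolding c_def tail_sum_def K_def[symmetric]
    by (intro ext fps_divide_eq_mult prod_rqpoch_mult_prod_qpoch)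
  have idx: "multi_indices k = (\<Pi>\<^sub>E s\<in>{1..K}. UNIV)"
    by (simp add: multi_indices_def K_def)
  have pair: "qfps.bailey_pair (\<lambda>r. fps_X ^ (r * (r + 1)) * ?\<alpha> r) rqpoch"
    using qfps.bailey_pair_step[OF qfps.bailey_pair_unit] unfolding qfps.bailey_step_unit .
  have "a summable_on UNIV"
    using fps_graded_summable_nat(1)[of 0 a] a by (simp add: atLeast_0)
  moreover have "b summable_on {1..}"
    using b by (intro fps_graded_summable_nat(1))
  moreover have "c summable_on multi_indices k \<and>
      infsum a UNIV + infsum b {1..} = qpoch_inf fps_X fps_X * infsum c (multi_indices k)"
  \<comment> \<open>For \<open>k = 1\<close> the multiple sum is the single term 1, and the claim is
    Euler's pentagonal number theorem. It is the limit of the initial pair itself, with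
    \<open>S = 1\<close>.\<close>
  proof (cases "K = 0")
    case True
    then have "c = (\<lambda>l. 1)" "multi_indices k = {\<lambda>_. undefined}"
      unfolding c idx by simp_all
    moreover have "infsum a UNIV + infsum b {1..} = qpoch_inf fps_X fps_X"
    proof (rule infsum_add_infsum_eqI[OF a b])
      fix N
      have "fps_cong N (qpoch_inf fps_X fps_X * 1) (\<Sum>r<N. fps_X ^ (r * (r + 1)) * ?\<alpha> r)"
      proof (rule bailey_pair_limit[OF pair])
        show "fps_cong r (fps_X ^ (r * (r + 1)) * ?\<alpha> r) 0" for r
          by (intro fps_cong_0_mult(1) fps_cong_X_power) simp
        show "fps_cong N (qpoch_inf fps_X fps_X * rqpoch (2 * N) :: 'a fps) 1"
          by (intro qpoch_inf_mult_rqpoch) simp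
      qed
      then show "fps_cong N (qpoch_inf fps_X fps_X) (\<Sum>r<N. a r + b (r + 1))"
        unfolding ab[symmetric] True mult_0 power_0 mult_1_left mult_1_right .
    qed
    ultimately show ?thesis by simp
  next
    case False
    then have K: "1 \<le> K" by simp
    \<comment> \<open>Splitting off the innermost index exposes \<open>rqpoch (l K)\<close> as the
      initial \<open>\<beta>\<close>.\<close>
    have "{1..K} = insert K {1..<K}" using K by auto
    then have c': "c = (\<lambda>l. fps_X ^ (\<Sum>s=1..K. sum l {s..K} * (sum l {s..K} + 1)) *
        (rqpoch (l K) * (\<Prod>s=1..<K. rqpoch (l s))))"
      unfolding c by simp
    show ?thesis
      unfolding c' idx
      by (intro conjI infsum_add_infsum_eqI[OF a b] bailey_chain_multi_sum(1)[OF pair K]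
          bailey_chain_multi_sum(2)[OF pair K, unfolded ab])
  qed
  ultimately show "let a = (\<lambda>i::nat. (-1) ^ i * q ^ (k * (i^2 + i)) * q ^ (i * (i - 1) div 2));
           b = (\<lambda>i::nat. (-1) ^ i * q ^ (k * (i^2 - i)) * q ^ (i * (i + 1) div 2));
           c = (\<lambda>l. q ^ (\<Sum>j=1..k-1. tail_sum k l j * (tail_sum k l j + 1)) /
                  (\<Prod>j=1..k-1. qpoch q q (l j)))
       in a summable_on UNIV \<and> b summable_on {1..} \<and> c summable_on multi_indices k \<and>
          (\<Sum>\<^sub>\<infinity>i. a i) + (\<Sum>\<^sub>\<infinity>i\<in>{1..}. b i) =
            qpoch_inf q q * (\<Sum>\<^sub>\<infinity>l\<in>multi_indices k. c l)"
    unfolding Let_def q_def a_def[abs_def, symmetric] b_def[abs_def, symmetric] c_def[abs_def, symmetric]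
    by simp
qed

end
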